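(* Let $(\mathcal{A},\cdot,[\cdot,\cdot])$ be a Lie-Poisson superalgebra over $\mathbb{C}$, let $\xi\in\mathbb{C}$ be a constant, and let $d$ be an even derivation of the algebra $(\mathcal{A},\cdot)$ such that $$d[u,v]=[d(u),v]+[u,d(v)]+\xi[u,v]\qquad\text{for all }u,v\in\mathcal{A}.$$ Define $u\circ v=u\,d(v)+\xi uv$ for $u,v\in\mathcal{A}$. Then $(\mathcal{A},[\cdot,\cdot],\circ)$ is a super Gel'fand-Dorfman bialgebra.
   Context: All vector spaces are over $\mathbb{C}$. All operations are bilinear and $\mathbb{Z}_2$-graded. A super commutative associative algebra is a $\mathbb{Z}_2$-graded associative algebra $\mathcal{A}=\mathcal{A}_0\oplus\mathcal{A}_1$ with $uv=(-1)^{ij}vu$ for $u\in\mathcal{A}_i,v\in\mathcal{A}_j$. An even derivation is a linear map $d$ with $d(\mathcal{A}_j)\subset\mathcal{A}_j$ and $d(uv)=d(u)v+u\,d(v)$. A Lie superalgebra $L=L_0\oplus L_1$ satisfies $[u,v]=-(-1)^{ij}[v,u]$ and $[w,[v,u]]=[[w,v],u]-(-1)^{ij}[[w,u],v]$ for $u\in L_i,v\in L_j,w\in L$. A Lie-Poisson superalgebra is a $\mathbb{Z}_2$-graded space $\mathcal{A}$ with operations $\cdot$ and $[\cdot,\cdot]$ such that $(\mathcal{A},\cdot)$ is a super commutative associative algebra, $(\mathcal{A},[\cdot,\cdot])$ is a Lie superalgebra and $[u,v\cdot w]=[u,v]\cdot w+(-1)^{ij}v\cdot[u,w]$ for $u\in\mathcal{A}_i,v\in\mathcal{A}_j,w\in\mathcal{A}$.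 A Novikov superalgebra $(\mathcal{B},\circ)$ satisfies $(u\circ v)\circ w=(-1)^{jl}(u\circ w)\circ v$ and $(u,v,w)=(-1)^{ij}(v,u,w)$ for $u\in\mathcal{B}_i,v\in\mathcal{B}_j,w\in\mathcal{B}_l$, where $(u,v,w)=(u\circ v)\circ w-u\circ(v\circ w)$. A super Gel'fand-Dorfman bialgebra $(\mathcal{B},[\cdot,\cdot],\circ)$ is a $\mathbb{Z}_2$-graded space such that $(\mathcal{B},[\cdot,\cdot])$ is a Lie superalgebra, $(\mathcal{B},\circ)$ is a Novikov superalgebra and $$[w\circ u,v]-(-1)^{ij}[w\circ v,u]+[w,u]\circ v-(-1)^{ij}[w,v]\circ u-w\circ[u,v]=0$$ for $u\in\mathcal{B}_i$, $v\in\mathcal{B}_j$, $w\in\mathcal{B}$. *)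

theory Defs
  imports Complex_Main "HOL-Library.Z2"
begin

text \<open>
  The type \<^typ>\<open>bit\<close> is the two-element field, so \<open>i + j\<close> and \<open>i * j\<close> for parities \<open>i\<close>, \<open>j\<close>
  are taken modulo 2, and \<open>(-1)\<^sup>i\<^sup>j\<close> is \<open>parity_sign (i * j)\<close>.
\<close>

definition parity_sign :: "bit \<Rightarrow> complex"
  where "parity_sign i = (if i = 0 then 1 else - 1)"

locale superspace = vector_space scale
  for scale :: "complex \<Rightarrow> 'a::ab_group_add \<Rightarrow> 'a" (infixr "*s" 75) +
  fixes V :: "bit \<Rightarrow> 'a set"
  assumes subspace_component: "subspace (V i)"
    and components_inter: "V 0 \<inter> V 1 = {0}"
    and components_sum: "\<exists>a\<in>V 0. \<exists>b\<in>V 1. x = a + b"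

locale superalgebra = superspace scale V
  for scale :: "complex \<Rightarrow> 'a::ab_group_add \<Rightarrow> 'a" (infixr "*s" 75)
    and V :: "bit \<Rightarrow> 'a set" +
  fixes mult :: "'a \<Rightarrow> 'a \<Rightarrow> 'a"
  assumes linear_right: "Vector_Spaces.linear scale scale (\<lambda>v. mult u v)"
    and linear_left: "Vector_Spaces.linear scale scale (\<lambda>u. mult u v)"
    and graded: "u \<in> V i \<Longrightarrow> v \<in> V j \<Longrightarrow> mult u v \<in> V (i + j)"

text \<open>No unit element is required.\<close>

locale super_comm_assoc_algebra = superalgebra scale V mult
  for scale :: "complex \<Rightarrow> 'a::ab_group_add \<Rightarrow> 'a" (infixr "*s" 75)
    and V :: "bit \<Rightarrow> 'a set"
    and mult :: "'a \<Rightarrow> 'a \<Rightarrow> 'a" (infixl "\<cdot>" 70) +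
  assumes assoc: "(u \<cdot> v) \<cdot> w = u \<cdot> (v \<cdot> w)"
    and super_comm: "u \<in> V i \<Longrightarrow> v \<in> V j \<Longrightarrow> u \<cdot> v = parity_sign (i * j) *s (v \<cdot> u)"

locale even_derivation = superalgebra scale V mult
  for scale :: "complex \<Rightarrow> 'a::ab_group_add \<Rightarrow> 'a" (infixr "*s" 75)
    and V :: "bit \<Rightarrow> 'a set"
    and mult :: "'a \<Rightarrow> 'a \<Rightarrow> 'a" (infixl "\<cdot>" 70) +
  fixes d :: "'a \<Rightarrow> 'a"
  assumes linear_deriv: "Vector_Spaces.linear scale scale d"
    and even_deriv: "u \<in> V j \<Longrightarrow> d u \<in> V j"
    and deriv_mult: "d (u \<cdot> v) = d u \<cdot> v + u \<cdot> d v"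

locale lie_superalgebra = superalgebra scale V bracket
  for scale :: "complex \<Rightarrow> 'a::ab_group_add \<Rightarrow> 'a" (infixr "*s" 75)
    and V :: "bit \<Rightarrow> 'a set"
    and bracket :: "'a \<Rightarrow> 'a \<Rightarrow> 'a" +
  assumes super_skew:
      "u \<in> V i \<Longrightarrow> v \<in> V j \<Longrightarrow> bracket u v = - (parity_sign (i * j) *s bracket v u)"
    and super_jacobi:
      "u \<in> V i \<Longrightarrow> v \<in> V j \<Longrightarrow>
        bracket w (bracket v u) =
          bracket (bracket w v) u - parity_sign (i * j) *s bracket (bracket w u) v"

locale lie_poisson_superalgebra =
  super_comm_assoc_algebra scale V mult + lie: lie_superalgebra scale V bracket
  for scale :: "complex \<Rightarrow> 'a::ab_group_add \<Rightarrow> 'a" (infixr "*s" 75)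
    and V :: "bit \<Rightarrow> 'a set"
    and mult :: "'a \<Rightarrow> 'a \<Rightarrow> 'a" (infixl "\<cdot>" 70)
    and bracket :: "'a \<Rightarrow> 'a \<Rightarrow> 'a" +
  assumes super_leibniz:
      "u \<in> V i \<Longrightarrow> v \<in> V j \<Longrightarrow>
        bracket u (v \<cdot> w) = bracket u v \<cdot> w + parity_sign (i * j) *s (v \<cdot> bracket u w)"

definition associator :: "('a \<Rightarrow> 'a \<Rightarrow> 'a) \<Rightarrow> 'a \<Rightarrow> 'a \<Rightarrow> 'a \<Rightarrow> 'a::ab_group_add"
  where "associator m u v w = m (m u v) w - m u (m v w)"

locale novikov_superalgebra = superalgebra scale V circ
  for scale :: "complex \<Rightarrow> 'a::ab_group_add \<Rightarrow> 'a" (infixr "*s" 75)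
    and V :: "bit \<Rightarrow> 'a set"
    and circ :: "'a \<Rightarrow> 'a \<Rightarrow> 'a" (infixl "\<odot>" 70) +
  assumes super_right_comm:
      "u \<in> V i \<Longrightarrow> v \<in> V j \<Longrightarrow> w \<in> V l \<Longrightarrow>
        (u \<odot> v) \<odot> w = parity_sign (j * l) *s ((u \<odot> w) \<odot> v)"
    and super_left_symmetric:
      "u \<in> V i \<Longrightarrow> v \<in> V j \<Longrightarrow> w \<in> V l \<Longrightarrow>
        associator circ u v w = parity_sign (i * j) *s associator circ v u w"

locale super_gelfand_dorfman_bialgebra =
  lie_superalgebra scale V bracket + novikov: novikov_superalgebra scale V circ
  for scale :: "complex \<Rightarrow> 'a::ab_group_add \<Rightarrow> 'a" (infixr "*s" 75)
    and V :: "bit \<Rightarrow> 'a set"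
    and bracket :: "'a \<Rightarrow> 'a \<Rightarrow> 'a"
    and circ :: "'a \<Rightarrow> 'a \<Rightarrow> 'a" (infixl "\<odot>" 70) +
  assumes gelfand_dorfman:
      "u \<in> V i \<Longrightarrow> v \<in> V j \<Longrightarrow>
        bracket (w \<odot> u) v - parity_sign (i * j) *s bracket (w \<odot> v) u
        + bracket w u \<odot> v - parity_sign (i * j) *s (bracket w v \<odot> u)
        - w \<odot> bracket u v = 0"

end

theory Submission
  imports Defs
begin

text \<open>
  With \<open>D = d + \<xi>\<close> the new product is \<open>u \<circ> v = u \<cdot> D v\<close>. The hypothesis on \<open>d\<close> says that
  \<open>D\<close> is an honest derivation of the bracket, while \<open>D (u \<cdot> v) = D u \<cdot> v + u \<cdot> D v - \<xi> (u \<cdot> v)\<close>.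
  The associator is then \<open>u \<cdot> v \<cdot> (\<xi> D w - D (D w))\<close>, visibly supersymmetric in \<open>u\<close> and \<open>v\<close>.
  In the compatibility condition, the Leibniz rule expands \<open>[w \<cdot> D u, v]\<close> and \<open>[w \<cdot> D v, u]\<close>;
  the terms \<open>[w, u] \<cdot> D v\<close> and \<open>[w, v] \<cdot> D u\<close> cancel, and what remains is
  \<open>w \<cdot> ([D u, v] + [u, D v] - D [u, v]) = 0\<close>.
\<close>

lemma parity_sign_square [simp]: "parity_sign i * parity_sign i = 1"
  by (simp add: parity_sign_def)

context superalgebra
begin

lemma mult_add_right: "mult u (v + w) = mult u v + mult u w"
  and mult_diff_right: "mult u (v - w) = mult u v - mult u w"
  and mult_minus_right: "mult u (- v) = - mult u v"
  and mult_scale_right: "mult u (c *s v) = c *s mult u v"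
proof -
  interpret f: Vector_Spaces.linear scale scale "mult u" by (rule linear_right)
  show "mult u (v + w) = mult u v + mult u w" by (rule f.add)
  show "mult u (v - w) = mult u v - mult u w" by (rule f.diff)
  show "mult u (- v) = - mult u v" by (rule f.neg)
  show "mult u (c *s v) = c *s mult u v" by (rule f.scale)
qed

lemma mult_add_left: "mult (u + v) w = mult u w + mult v w"
  and mult_minus_left: "mult (- u) w = - mult u w"
  and mult_scale_left: "mult (c *s u) w = c *s mult u w"
proof -
  interpret f: Vector_Spaces.linear scale scale "\<lambda>u. mult u w" by (rule linear_left)
  show "mult (u + v) w = mult u w + mult v w" by (rule f.add)
  show "mult (- u) w = - mult u w" by (rule f.neg)
  show "mult (c *s u) w = c *s mult u w" by (rule f.scale)
qed

end

text \<open>For homogeneous \<open>w\<close>, skew-symmetry moves \<open>v\<close> to the front,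
  \<open>super_leibniz\<close> expands the product, and skew-symmetry moves \<open>v\<close>
  back.\<close>

lemma (in lie_poisson_superalgebra) super_leibniz_left:
  assumes x: "x \<in> V i" and v: "v \<in> V j"
  shows "bracket (w \<cdot> x) v = w \<cdot> bracket x v + parity_sign (i * j) *s (bracket w v \<cdot> x)"
proof -
  have hom: "bracket (w \<cdot> x) v = w \<cdot> bracket x v + parity_sign (i * j) *s (bracket w v \<cdot> x)"
    if w: "w \<in> V l" for w l
  proof -
    have "bracket (w \<cdot> x) v = - (parity_sign ((l + i) * j) *s bracket v (w \<cdot> x))"
      by (rule lie.super_skew[OF graded[OF w x] v])
    also have "\<dots> = - (parity_sign ((l + i) * j) *s (bracket v w \<cdot> x))
        - (parity_sign ((l + i) * j) * parity_sign (j * l)) *s (w \<cdot> bracket v x)"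
      by (simp add: super_leibniz[OF v w] scale_right_distrib)
    \<comment> \<open>The parity \<open>l\<close> of \<open>w\<close> drops out, because the sign
      for \<open>(l + i) * j\<close> is the product of those for \<open>l * j\<close> and
      \<open>i * j\<close>.\<close>
    also have "\<dots> = parity_sign (i * j) *s (bracket w v \<cdot> x) + w \<cdot> bracket x v"
      unfolding lie.super_skew[OF w v] lie.super_skew[OF x v]
      by (cases i; cases j; cases l)
        (simp_all add: parity_sign_def mult_minus_left mult_minus_right)
    finally show ?thesis by (simp add: add.commute)
  qed
  \<comment> \<open>The remaining sign is the same for both components of \<open>w\<close>, so
    additivity gives the identity for arbitrary \<open>w\<close>.\<close>
  obtain a b where "a \<in> V 0" "b \<in> V 1" "w = a + b" using components_sum by blast
  then show ?thesis
    using hom by (simp add: mult_add_left lie.mult_add_left scale_right_distrib)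
qed

locale lie_poisson_twisted_derivation =
  lie_poisson_superalgebra scale V mult bracket + even_derivation scale V mult d
  for scale :: "complex \<Rightarrow> 'a::ab_group_add \<Rightarrow> 'a" (infixr "*s" 75)
    and V :: "bit \<Rightarrow> 'a set"
    and mult :: "'a \<Rightarrow> 'a \<Rightarrow> 'a" (infixl "\<cdot>" 70)
    and bracket :: "'a \<Rightarrow> 'a \<Rightarrow> 'a"
    and d :: "'a \<Rightarrow> 'a" +
  fixes \<xi> :: complex
  assumes deriv_bracket:
    "d (bracket u v) = bracket (d u) v + bracket u (d v) + \<xi> *s bracket u v"
begin

definition D :: "'a \<Rightarrow> 'a"
  where "D u = d u + \<xi> *s u"

definition circ :: "'a \<Rightarrow> 'a \<Rightarrow> 'a" (infixl "\<odot>" 70)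
  where "u \<odot> v = u \<cdot> D v"

lemma D_add: "D (u + v) = D u + D v"
  and D_scale: "D (c *s u) = c *s D u"
proof -
  interpret d: Vector_Spaces.linear scale scale d by (rule linear_deriv)
  show "D (u + v) = D u + D v" by (simp add: D_def d.add scale_right_distrib)
  show "D (c *s u) = c *s D u" by (simp add: D_def d.scale scale_right_distrib mult.commute)
qed

lemma D_even: "u \<in> V i \<Longrightarrow> D u \<in> V i"
  unfolding D_def by (intro subspace_add subspace_scale subspace_component even_deriv)

lemma D_mult: "D (u \<cdot> v) = D u \<cdot> v + u \<cdot> D v - \<xi> *s (u \<cdot> v)"
  by (simp add: D_def deriv_mult mult_add_left mult_add_right mult_scale_left mult_scale_right)

text \<open>The right side contains \<xi> times the bracket twice; on the left one copy comes from
  \<open>D_def\<close>, the other from \<open>deriv_bracket\<close>.\<close>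

lemma D_bracket: "D (bracket u v) = bracket (D u) v + bracket u (D v)"
  by (simp add: D_def deriv_bracket lie.mult_add_left lie.mult_add_right lie.mult_scale_left
      lie.mult_scale_right)

text \<open>Expanding \<open>D (v \<cdot> D w)\<close> by \<open>D_mult\<close> produces a term
  \<open>D v \<cdot> D w\<close> that cancels the first half of the associator.\<close>

lemma associator_circ: "associator circ u v w = (u \<cdot> v) \<cdot> (\<xi> *s D w - D (D w))"
  by (simp add: associator_def circ_def D_mult assoc mult_add_right mult_diff_right
      mult_scale_right)

sublocale circ: superalgebra scale V circ
proof (intro superalgebra.intro superspace_axioms superalgebra_axioms.intro)
  show "Vector_Spaces.linear scale scale (\<lambda>v. u \<odot> v)" for u
    by unfold_locales (simp_all add: circ_def D_add D_scale mult_add_right mult_scale_right)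
  show "Vector_Spaces.linear scale scale (\<lambda>u. u \<odot> v)" for v
    by unfold_locales (simp_all add: circ_def mult_add_left mult_scale_left)
  show "u \<odot> v \<in> V (i + j)" if "u \<in> V i" "v \<in> V j" for u v i j
    unfolding circ_def using that by (intro graded D_even)
qed

sublocale novikov_superalgebra scale V circ
proof
  fix u v w i j l
  assume u: "u \<in> V i" and v: "v \<in> V j" and w: "w \<in> V l"
  \<comment> \<open>Since \<open>D\<close> is even, \<open>D v\<close> and \<open>D w\<close>
    commute with the same sign as \<open>v\<close> and \<open>w\<close>.\<close>
  show "(u \<odot> v) \<odot> w = parity_sign (j * l) *s ((u \<odot> w) \<odot> v)"
    using super_comm[OF D_even[OF v] D_even[OF w]]
    by (simp add: circ_def assoc mult_scale_right)
  show "associator circ u v w = parity_sign (i * j) *s associator circ v u w"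
    unfolding associator_circ super_comm[OF u v] by (rule mult_scale_left)
qed

sublocale super_gelfand_dorfman_bialgebra scale V bracket circ
proof
  fix u v w i j
  assume u: "u \<in> V i" and v: "v \<in> V j"
  let ?s = "parity_sign (i * j)"
  have "bracket (w \<odot> u) v = w \<cdot> bracket (D u) v + ?s *s (bracket w v \<cdot> D u)"
    unfolding circ_def by (rule super_leibniz_left[OF D_even[OF u] v])
  \<comment> \<open>The sign from the Leibniz rule meets the prefactor \<open>?s\<close> and squares
    to 1.\<close>
  moreover have "?s *s bracket (w \<odot> v) u = ?s *s (w \<cdot> bracket (D v) u) + bracket w u \<cdot> D v"
    unfolding circ_def super_leibniz_left[OF D_even[OF v] u]
    by (simp add: scale_right_distrib mult.commute[of j i])
  moreover have "?s *s (w \<cdot> bracket (D v) u) = - (w \<cdot> bracket u (D v))"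
    unfolding lie.super_skew[OF u D_even[OF v]] by (simp add: mult_minus_right mult_scale_right)
  ultimately show "bracket (w \<odot> u) v - ?s *s bracket (w \<odot> v) u + bracket w u \<odot> v
      - ?s *s (bracket w v \<odot> u) - w \<odot> bracket u v = 0"
    by (simp add: circ_def D_bracket mult_add_right)
qed

end

theorem theorem3p2:
  fixes scale :: "complex \<Rightarrow> 'a::ab_group_add \<Rightarrow> 'a"
    and A :: "bit \<Rightarrow> 'a set"
    and mult bracket :: "'a \<Rightarrow> 'a \<Rightarrow> 'a"
    and d :: "'a \<Rightarrow> 'a"
    and \<xi> :: complex
  assumes "lie_poisson_superalgebra scale A mult bracket"
    and "even_derivation scale A mult d"
    and "\<And>u v. d (bracket u v) = bracket (d u) v + bracket u (d v) + scale \<xi> (bracket u v)"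
  shows "super_gelfand_dorfman_bialgebra scale A bracket
           (\<lambda>u v. mult u (d v) + scale \<xi> (mult u v))"
proof -
  interpret lie_poisson_twisted_derivation scale A mult bracket d \<xi>
    using assms
    by (simp add: lie_poisson_twisted_derivation_def lie_poisson_twisted_derivation_axioms_def)
  have "circ = (\<lambda>u v. mult u (d v) + scale \<xi> (mult u v))"
    by (simp add: fun_eq_iff circ_def D_def mult_add_right mult_scale_right)
  with super_gelfand_dorfman_bialgebra_axioms show ?thesis by simp
qed

end
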